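(* Let $\mathscr{T}\in\mathbb{R}^{n_1\times n_2\times n_3}$ be a third-order tensor in the HTD/TD format with core tensor $\mathscr{G}\in\mathbb{R}^{r_1\times r_2\times r_3}$, and factor matrices $\mathbf{U}_1\in\mathbb{R}^{n_1\times r_1}$, $\mathbf{U}_2\in\mathbb{R}^{n_2\times r_2}$, and $\mathbf{U}_3\in\mathbb{R}^{n_3\times r_3}$. Then the diagonal block matrices of $\mathscr{T}$ in the Fourier domain are computed as $$\mathbf{T}_{j_3}(j_1,j_2)=\sum_{\alpha_1=1}^{r_1}\sum_{\alpha_2=1}^{r_2}\sum_{\alpha_3=1}^{r_3}\mathscr{G}(\alpha_1,\alpha_2,\alpha_3)\,\mathbf{U}_1(j_1,\alpha_1)\,\mathbf{U}_2(j_2,\alpha_2)\,\widetilde{\mathbf{U}}_3(j_3,\alpha_3),$$ where $\widetilde{\mathbf{U}}_3=\mathbf{F}_{n_3}\mathbf{U}_3$, for $j_3=1,2,\dots,n_3$.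
   Context: For third-order tensors, the hierarchical Tucker (HTD) format is taken to be the standard Tucker (TD) format: $\mathscr{T}=\mathscr{G}\times_1\mathbf{U}_1\times_2\mathbf{U}_2\times_3\mathbf{U}_3$, i.e. $\mathscr{T}(j_1,j_2,j_3)=\sum_{\alpha_1,\alpha_2,\alpha_3}\mathscr{G}(\alpha_1,\alpha_2,\alpha_3)\mathbf{U}_1(j_1,\alpha_1)\mathbf{U}_2(j_2,\alpha_2)\mathbf{U}_3(j_3,\alpha_3)$. $\mathbf{F}_{n}\in\mathbb{C}^{n\times n}$ is the discrete Fourier transform matrix $\mathbf{F}_n(p,q)=\frac{1}{\sqrt{n}}\,\omega^{(p-1)(q-1)}$, $\omega=\exp(-2\pi i/n)$; ${}^*$ is the conjugate transpose and $\otimes$ the Kronecker product. $\texttt{bcirc}(\mathscr{T})\in\mathbb{R}^{n_1n_3\times n_2n_3}$ is the block-circulant matrix whose $(p,q)$ block ($p,q=1,\dots,n_3$) is the frontal slice $\mathscr{T}(:,:,((p-q)\bmod n_3)+1)$. The diagonal block matrices $\mathbf{T}_1,\dots,\mathbf{T}_{n_3}\in\mathbb{C}^{n_1\times n_2}$ of $\mathscr{T}$ in the Fourier domain are defined by $(\mathbf{F}_{n_3}\otimes\mathbf{I}_{n_1})\,\texttt{bcirc}(\mathscr{T})\,(\mathbf{F}_{n_3}^{*}\otimes\mathbf{I}_{n_2})=\texttt{blkdiag}(\mathbf{T}_1,\mathbf{T}_2,\dots,\mathbf{T}_{n_3})$, the block diagonal matrix with these blocks.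
   Formalization: The right-hand side of the formula for T_{j_3}(j_1,j_2) carries an extra factor sqrt(n_3): with the unitary F_{n_3} the printed formula fails, e.g. for n_3=2, all other sizes 1, G=U_1=U_2=1, U_3=(1,0)^T, where T_1=1 but the formula gives 1/sqrt(2). *)

theory Defs
  imports "HOL-Analysis.Analysis" "Jordan_Normal_Form.Schur_Decomposition"
begin

(* Indices start at 0 throughout, as in Jordan_Normal_Form.Matrix.  An n1 x n2 x n3 tensor is
   a function of three indices; only its values at j1 < n1, j2 < n2, j3 < n3 are ever used. *)
type_synonym 'a tensor3 = "nat \<Rightarrow> nat \<Rightarrow> nat \<Rightarrow> 'a"

(* T = G x_1 U1 x_2 U2 x_3 U3 *)
definition tucker_format ::
  "nat \<Rightarrow> nat \<Rightarrow> nat \<Rightarrow> nat \<Rightarrow> nat \<Rightarrow> nat \<Rightarrow> real tensor3 \<Rightarrow>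
   real tensor3 \<Rightarrow> real mat \<Rightarrow> real mat \<Rightarrow> real mat \<Rightarrow> bool" where
  "tucker_format n1 n2 n3 r1 r2 r3 T G U1 U2 U3 \<longleftrightarrow>
     U1 \<in> carrier_mat n1 r1 \<and> U2 \<in> carrier_mat n2 r2 \<and> U3 \<in> carrier_mat n3 r3 \<and>
     (\<forall>j1<n1. \<forall>j2<n2. \<forall>j3<n3. T j1 j2 j3 =
        (\<Sum>a1<r1. \<Sum>a2<r2. \<Sum>a3<r3. G a1 a2 a3 * U1 $$ (j1, a1) * U2 $$ (j2, a2) * U3 $$ (j3, a3)))"

(* Unitary normalisation 1 / sqrt n. *)
definition dft_mat :: "nat \<Rightarrow> complex mat" where
  "dft_mat n = mat n n (\<lambda>(p, q).
     complex_of_real (1 / sqrt (real n)) * exp (- 2 * complex_of_real pi * \<i> / of_nat n) ^ (p * q))"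

definition kronecker :: "'a::times mat \<Rightarrow> 'a mat \<Rightarrow> 'a mat" where
  "kronecker A B = mat (dim_row A * dim_row B) (dim_col A * dim_col B) (\<lambda>(i, j).
     A $$ (i div dim_row B, j div dim_col B) * B $$ (i mod dim_row B, j mod dim_col B))"

(* Entry (i, j) lies in block (i div n1, j div n2), at position (i mod n1, j mod n2) there.
   The difference of block indices is taken in int, since subtraction on nat truncates. *)
definition bcirc :: "nat \<Rightarrow> nat \<Rightarrow> nat \<Rightarrow> 'a tensor3 \<Rightarrow> 'a mat" where
  "bcirc n1 n2 n3 T = mat (n1 * n3) (n2 * n3) (\<lambda>(i, j).
     T (i mod n1) (j mod n2) (nat ((int (i div n1) - int (j div n2)) mod int n3)))"

definition fourier_blocks ::
  "nat \<Rightarrow> nat \<Rightarrow> nat \<Rightarrow> real tensor3 \<Rightarrow> complex mat list \<Rightarrow> bool" where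
  "fourier_blocks n1 n2 n3 T Ts \<longleftrightarrow>
     length Ts = n3 \<and> set Ts \<subseteq> carrier_mat n1 n2 \<and>
     kronecker (dft_mat n3) (1\<^sub>m n1) * map_mat complex_of_real (bcirc n1 n2 n3 T)
       * kronecker (mat_adjoint (dft_mat n3)) (1\<^sub>m n2)
     = diag_block_mat Ts"

end

theory Submission
  imports Defs
begin

text \<open>
  Two observations carry the proof. First, multiplication by \<open>kronecker A 1\<close> acts on a block
  matrix as \<open>A\<close> does on block indices, leaving the position inside a block alone. So the claim
  splits into one statement per position \<open>(j1, j2)\<close>, about the scalar circulant matrix with first
  column \<open>c = T j1 j2\<close>. Second, the Fourier matrix diagonalises every circulant: a cyclic
  shift of \<open>c\<close> by \<open>l\<close> multiplies its \<open>p\<close>-th Fourier coefficient by \<open>dft_root n ^ (p * l)\<close>,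
  so the sum over \<open>l\<close> left over in entry \<open>(p, q)\<close> is the inner product of two Fourier modes, which
  vanishes unless \<open>p = q\<close> (\<open>dft_mat_conj_circulant\<close>).

  Hence, for an arbitrary tensor, the blocks exist, are unique, and are the unnormalised discrete
  Fourier transforms along the third mode (\<open>fourier_blocks_iff\<close>). In the Tucker format
  the third index occurs in the factor \<open>U3\<close> alone, and by linearity the transform falls on that factor.
\<close>

section \<open>Diagonalisation of circulant matrices\<close>

definition dft_root :: "nat \<Rightarrow> complex" where
  "dft_root n = exp (- 2 * complex_of_real pi * \<i> / of_nat n)"

lemma cnj_dft_root_power:
  "cnj (dft_root n) ^ k = exp (2 * of_real pi * \<i> * of_nat k / of_nat n)"
proof -
  have "cnj (dft_root n) = exp (2 * of_real pi * \<i> / of_nat n)"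
    by (simp add: dft_root_def exp_cnj)
  then have "cnj (dft_root n) ^ k = exp (of_nat k * (2 * of_real pi * \<i> / of_nat n))"
    by (simp only: exp_of_nat_mult)
  then show ?thesis
    by (simp add: algebra_simps)
qed

lemma dft_root_mult_cnj: "dft_root n * cnj (dft_root n) = 1"
  by (simp add: dft_root_def exp_cnj flip: exp_add)

lemma cnj_dft_root_power_self: "n > 0 \<Longrightarrow> cnj (dft_root n) ^ n = 1"
  by (simp add: cnj_dft_root_power)

lemma dft_root_power_self:
  assumes "n > 0" shows "dft_root n ^ n = 1"
proof -
  have "cnj (dft_root n ^ n) = 1"
    using cnj_dft_root_power_self[OF assms] by simp
  then show ?thesis
    by (metis complex_cnj_cnj complex_cnj_one)
qed

lemma dft_root_orthogonal:
  assumes "p < n" "q < n"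
  shows "(\<Sum>l<n. dft_root n ^ (p * l) * cnj (dft_root n) ^ (q * l)) = (if p = q then of_nat n else 0)"
proof -
  define w where "w = dft_root n"
  define z where "z = w ^ p * cnj w ^ q"
  have n: "n > 0" using assms by simp
  have inv: "w ^ k * cnj w ^ k = 1" for k
    unfolding w_def by (metis dft_root_mult_cnj power_mult_distrib power_one)
  have sum_z: "(\<Sum>l<n. w ^ (p * l) * cnj w ^ (q * l)) = (\<Sum>l<n. z ^ l)"
    by (simp add: z_def power_mult power_mult_distrib)
  show ?thesis
  proof (cases "p = q")
    case True
    then have "z = 1" by (simp add: z_def inv)
    then show ?thesis using True sum_z by (simp add: w_def)
  next
    case False
    have "z \<noteq> 1"
    proof
      assume "z = 1"
      then have "cnj w ^ p = cnj w ^ q"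
        using inv[of p] unfolding z_def by (metis mult.assoc mult.commute mult.right_neutral)
      then have "p mod n = q mod n"
        using complex_root_unity_eq[of n p q] n by (simp add: w_def cnj_dft_root_power)
      then show False using assms False by simp
    qed
    moreover have "z ^ n = 1"
    proof -
      have "z ^ n = (w ^ n) ^ p * (cnj w ^ n) ^ q"
        by (simp add: z_def power_mult_distrib mult.commute flip: power_mult)
      then show ?thesis
        using n by (simp add: w_def dft_root_power_self cnj_dft_root_power_self)
    qed
    ultimately show ?thesis
      using False sum_z by (simp add: w_def geometric_sum)
  qed
qed

text \<open>
  The substitution \<open>k = (m + l) mod n\<close> undoes the shift; reducing the exponent mod \<open>n\<close> is harmless
  for an \<open>n\<close>-th root of unity.
\<close>
lemma sum_cyclic_shift:
  fixes z :: "'a::comm_semiring_1" and c :: "nat \<Rightarrow> 'a"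
  assumes z: "z ^ n = 1" and l: "l < n"
  shows "(\<Sum>k<n. z ^ k * c (nat ((int k - int l) mod int n))) = z ^ l * (\<Sum>m<n. z ^ m * c m)"
proof -
  have n: "n > 0" using l by simp
  have pow_mod: "z ^ (a mod n) = z ^ a" for a
  proof -
    have "z ^ a = z ^ (n * (a div n) + a mod n)" by simp
    also have "\<dots> = z ^ (a mod n)" by (simp only: power_add power_mult z) simp
    finally show ?thesis by simp
  qed
  have shift: "int (nat ((int k - int l) mod int n)) = (int k - int l) mod int n" for k
    using n by simp
  have "(\<Sum>k<n. z ^ k * c (nat ((int k - int l) mod int n))) = (\<Sum>m<n. z ^ ((m + l) mod n) * c m)"
  proof (rule sum.reindex_bij_witness[where i = "\<lambda>m. (m + l) mod n"
        and j = "\<lambda>k. nat ((int k - int l) mod int n)"])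
    fix k assume k: "k \<in> {..<n}"
    have "int ((nat ((int k - int l) mod int n) + l) mod n) = int k"
      using k by (simp add: shift zmod_int mod_simps)
    then show unshift: "(nat ((int k - int l) mod int n) + l) mod n = k" by linarith
    show "nat ((int k - int l) mod int n) \<in> {..<n}"
      using n by (simp add: nat_less_iff)
    show "z ^ ((nat ((int k - int l) mod int n) + l) mod n) * c (nat ((int k - int l) mod int n))
        = z ^ k * c (nat ((int k - int l) mod int n))"
      by (simp only: unshift)
  next
    fix m assume m: "m \<in> {..<n}"
    have "(int ((m + l) mod n) - int l) mod int n = int m"
      using m by (simp add: zmod_int mod_simps)
    then show "nat ((int ((m + l) mod n) - int l) mod int n) = m" by simp
    show "(m + l) mod n \<in> {..<n}" using n by simp
  qed
  also have "\<dots> = z ^ l * (\<Sum>m<n. z ^ m * c m)"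
    by (simp add: pow_mod power_add sum_distrib_left ac_simps)
  finally show ?thesis .
qed

lemma dft_mat_carrier: "dft_mat n \<in> carrier_mat n n"
  by (simp add: dft_mat_def)

lemma dft_mat_index:
  "p < n \<Longrightarrow> q < n \<Longrightarrow> dft_mat n $$ (p, q) = of_real (1 / sqrt (real n)) * dft_root n ^ (p * q)"
  by (simp add: dft_mat_def dft_root_def)

lemma mat_adjoint_carrier: "A \<in> carrier_mat m n \<Longrightarrow> mat_adjoint A \<in> carrier_mat n m"
  by (auto simp: mat_adjoint_def)

lemma mat_adjoint_index:
  "A \<in> carrier_mat m n \<Longrightarrow> i < n \<Longrightarrow> j < m \<Longrightarrow> mat_adjoint A $$ (i, j) = conjugate (A $$ (j, i))"
  by (auto simp: mat_adjoint_def mat_of_rows_index)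

text \<open>
  The normalisations of the two Fourier matrices multiply to \<open>1 / n\<close>, and the orthogonality
  relation contributes \<open>n\<close>. So the eigenvalues are the plain Fourier sums, which are \<open>sqrt n\<close>
  times those formed with the unitary matrix.
\<close>
lemma dft_mat_conj_circulant:
  fixes c :: "nat \<Rightarrow> complex"
  assumes p: "p < n" and q: "q < n"
  shows "(\<Sum>l<n. (\<Sum>k<n. dft_mat n $$ (p, k) * c (nat ((int k - int l) mod int n)))
            * mat_adjoint (dft_mat n) $$ (l, q))
       = (if p = q then of_real (sqrt (real n)) * (\<Sum>m<n. dft_mat n $$ (p, m) * c m) else 0)"
proof -
  define w where "w = dft_root n"
  define s :: complex where "s = of_real (1 / sqrt (real n))"
  have n: "n > 0" using p by simp
  have F: "dft_mat n $$ (p, k) = s * (w ^ p) ^ k" if "k < n" for k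
    using p that by (simp add: dft_mat_index s_def w_def power_mult)
  have F_adj: "mat_adjoint (dft_mat n) $$ (l, q) = s * cnj w ^ (q * l)" if "l < n" for l
    using q that by (simp add: mat_adjoint_index[OF dft_mat_carrier] dft_mat_index s_def w_def)
  have root: "(w ^ p) ^ n = 1"
    by (metis dft_root_power_self n mult.commute power_mult power_one w_def)
  have eigen: "(\<Sum>k<n. dft_mat n $$ (p, k) * c (nat ((int k - int l) mod int n)))
      = w ^ (p * l) * (\<Sum>m<n. dft_mat n $$ (p, m) * c m)" if l: "l < n" for l
  proof -
    have "(\<Sum>k<n. dft_mat n $$ (p, k) * c (nat ((int k - int l) mod int n)))
        = s * (\<Sum>k<n. (w ^ p) ^ k * c (nat ((int k - int l) mod int n)))"
      by (simp add: F sum_distrib_left mult.assoc)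
    also have "\<dots> = w ^ (p * l) * (\<Sum>m<n. s * (w ^ p) ^ m * c m)"
      unfolding sum_cyclic_shift[OF root l] power_mult by (simp add: sum_distrib_left ac_simps)
    finally show ?thesis by (simp add: F)
  qed
  define C where "C = (\<Sum>m<n. dft_mat n $$ (p, m) * c m)"
  have "(\<Sum>l<n. (\<Sum>k<n. dft_mat n $$ (p, k) * c (nat ((int k - int l) mod int n)))
            * mat_adjoint (dft_mat n) $$ (l, q))
      = s * C * (\<Sum>l<n. w ^ (p * l) * cnj w ^ (q * l))"
    unfolding sum_distrib_left by (rule sum.cong) (simp_all add: eigen F_adj C_def ac_simps)
  moreover have "s * of_nat n = of_real (sqrt (real n))"
  proof -
    have "1 / sqrt (real n) * real n = sqrt (real n)"
      by (simp add: real_div_sqrt)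
    then show ?thesis unfolding s_def by (metis of_real_mult of_real_of_nat_eq)
  qed
  ultimately show ?thesis
    using dft_root_orthogonal[OF p q] by (simp add: w_def C_def ac_simps)
qed

section \<open>Matrices in blocks of equal size\<close>

lemma sum_blocks:
  fixes f :: "nat \<Rightarrow> 'a::comm_monoid_add"
  shows "(\<Sum>i<m * a. f i) = (\<Sum>k<m. \<Sum>r<a. f (k * a + r))"
proof -
  have "(\<Sum>r<a. f (k * a + r)) = sum f {k * a..<k * a + a}" for k
    using sum.shift_bounds_nat_ivl[of f 0 "k * a" a]
    by (simp add: lessThan_atLeast0 add.commute)
  then show ?thesis
    by (simp add: sum.nat_group)
qed

lemma div_less_of_less_mult: "i < m * a \<Longrightarrow> i div a < (m::nat)"
  by (simp add: less_mult_imp_div_less)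

lemma mod_less_of_less_mult: "i < m * a \<Longrightarrow> i mod a < (a::nat)"
  by (cases "a = 0") auto

lemma block_index_less:
  fixes k r m a :: nat
  assumes "k < m" "r < a"
  shows "k * a + r < m * a"
proof -
  have "k * a + r < Suc k * a" using assms by simp
  also have "\<dots> \<le> m * a" using assms by (intro mult_le_mono1) simp
  finally show ?thesis .
qed

lemma kronecker_one_carrier:
  "A \<in> carrier_mat m n \<Longrightarrow> kronecker A (1\<^sub>m a) \<in> carrier_mat (m * a) (n * a)"
  by (auto simp: kronecker_def)

lemma kronecker_one_index:
  fixes A :: "'a::semiring_1 mat"
  assumes "A \<in> carrier_mat m n" "i < m * a" "j < n * a"
  shows "kronecker A (1\<^sub>m a) $$ (i, j) = (if i mod a = j mod a then A $$ (i div a, j div a) else 0)"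
  using assms mod_less_of_less_mult[of i m a] mod_less_of_less_mult[of j n a]
  by (auto simp: kronecker_def)

lemma kronecker_one_mult_index:
  fixes A :: "'a::semiring_1 mat"
  assumes A: "A \<in> carrier_mat m n" and B: "B \<in> carrier_mat (n * a) c"
    and i: "i < m * a" and j: "j < c"
  shows "(kronecker A (1\<^sub>m a) * B) $$ (i, j)
       = (\<Sum>k<n. A $$ (i div a, k) * B $$ (k * a + i mod a, j))"
proof -
  have r: "i mod a < a" using i by (rule mod_less_of_less_mult)
  have "(kronecker A (1\<^sub>m a) * B) $$ (i, j)
      = (\<Sum>h<n * a. kronecker A (1\<^sub>m a) $$ (i, h) * B $$ (h, j))"
    using kronecker_one_carrier[OF A, of a] B i j
    by (auto simp: scalar_prod_def lessThan_atLeast0)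
  also have "\<dots> = (\<Sum>k<n. \<Sum>r<a. if r = i mod a then A $$ (i div a, k) * B $$ (k * a + r, j) else 0)"
    unfolding sum_blocks
    by (intro sum.cong refl) (auto simp: kronecker_one_index[OF A i] block_index_less)
  also have "\<dots> = (\<Sum>k<n. A $$ (i div a, k) * B $$ (k * a + i mod a, j))"
    using r by simp
  finally show ?thesis .
qed

lemma mult_kronecker_one_index:
  fixes A :: "'a::semiring_1 mat"
  assumes A: "A \<in> carrier_mat m n" and B: "B \<in> carrier_mat c (m * a)"
    and i: "i < c" and j: "j < n * a"
  shows "(B * kronecker A (1\<^sub>m a)) $$ (i, j)
       = (\<Sum>k<m. B $$ (i, k * a + j mod a) * A $$ (k, j div a))"
proof -
  have r: "j mod a < a" using j by (rule mod_less_of_less_mult)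
  have "(B * kronecker A (1\<^sub>m a)) $$ (i, j)
      = (\<Sum>h<m * a. B $$ (i, h) * kronecker A (1\<^sub>m a) $$ (h, j))"
    using kronecker_one_carrier[OF A, of a] B i j
    by (auto simp: scalar_prod_def lessThan_atLeast0)
  also have "\<dots> = (\<Sum>k<m. \<Sum>r<a. if r = j mod a then B $$ (i, k * a + r) * A $$ (k, j div a) else 0)"
    unfolding sum_blocks
    by (intro sum.cong refl) (auto simp: kronecker_one_index[OF A _ j] block_index_less)
  also have "\<dots> = (\<Sum>k<m. B $$ (i, k * a + j mod a) * A $$ (k, j div a))"
    using r by simp
  finally show ?thesis .
qed

lemma diag_block_mat_uniform_carrier:
  assumes "set As \<subseteq> carrier_mat a b"
  shows "diag_block_mat As \<in> carrier_mat (length As * a) (length As * b)"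
  using assms by (induction As) (auto simp: Let_def)

lemma diag_block_mat_uniform_index:
  assumes "set As \<subseteq> carrier_mat a b" "i < length As * a" "j < length As * b"
  shows "diag_block_mat As $$ (i, j)
       = (if i div a = j div b then (As ! (i div a)) $$ (i mod a, j mod b) else 0)"
  using assms
proof (induction As arbitrary: i j)
  case Nil
  then show ?case by simp
next
  case (Cons A As)
  let ?B = "diag_block_mat As"
  have A: "A \<in> carrier_mat a b" and As: "set As \<subseteq> carrier_mat a b"
    using Cons.prems by auto
  have B: "?B \<in> carrier_mat (length As * a) (length As * b)"
    using As by (rule diag_block_mat_uniform_carrier)
  have pos: "a > 0" "b > 0" using Cons.prems by (auto intro: gr0I)
  have entry: "diag_block_mat (A # As) $$ (i, j)
      = (if i < a then if j < b then A $$ (i, j) else 0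
         else if j < b then 0 else ?B $$ (i - a, j - b))"
    using A B Cons.prems by (auto simp: Let_def)
  have div_mod: "x div d = Suc ((x - d) div d) \<and> x mod d = (x - d) mod d"
    if "d \<le> x" "d > 0" for x d :: nat
    using that by (simp add: le_div_geq le_mod_geq)
  show ?case
  proof (cases "a \<le> i \<and> b \<le> j")
    case True
    then have "i - a < length As * a" "j - b < length As * b"
      using Cons.prems by auto
    from Cons.IH[OF As this] show ?thesis
      using True entry div_mod[of a i] div_mod[of b j] pos by simp
  next
    case False
    then show ?thesis
      using entry pos div_mod[of a i] div_mod[of b j] by (auto simp: not_le)
  qed
qed

text \<open>
  Blocks of a common known size occupy known positions and can be read off the block diagonal
  matrix; without a common size, the same matrix may admit several decompositions.
\<close>
lemma diag_block_mat_uniform_inject: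
  assumes As: "set As \<subseteq> carrier_mat a b" and Bs: "set Bs \<subseteq> carrier_mat a b"
    and len: "length As = length Bs" and eq: "diag_block_mat As = diag_block_mat Bs"
  shows "As = Bs"
proof (rule nth_equalityI[OF len])
  fix k assume k: "k < length As"
  have carr: "As ! k \<in> carrier_mat a b" "Bs ! k \<in> carrier_mat a b"
    using As Bs k len by (auto simp: subset_iff)
  show "As ! k = Bs ! k"
  proof (rule eq_matI)
    fix r s assume "r < dim_row (Bs ! k)" "s < dim_col (Bs ! k)"
    then have rs: "r < a" "s < b" using carr by auto
    then have "k * a + r < length As * a" "k * b + s < length As * b"
      using k by (simp_all add: block_index_less)
    from diag_block_mat_uniform_index[OF As this] diag_block_mat_uniform_index[OF Bs, folded len, OF this]
    show "As ! k $$ (r, s) = Bs ! k $$ (r, s)"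
      using rs eq by simp
  qed (use carr in auto)
qed

section \<open>The Fourier blocks of a tensor\<close>

definition dft_slices :: "nat \<Rightarrow> nat \<Rightarrow> nat \<Rightarrow> real tensor3 \<Rightarrow> complex mat list" where
  "dft_slices n1 n2 n3 T = map (\<lambda>p. mat n1 n2 (\<lambda>(j1, j2).
     of_real (sqrt (real n3)) * (\<Sum>m<n3. dft_mat n3 $$ (p, m) * of_real (T j1 j2 m)))) [0..<n3]"

lemma dft_slices_carrier:
  "length (dft_slices n1 n2 n3 T) = n3" "set (dft_slices n1 n2 n3 T) \<subseteq> carrier_mat n1 n2"
  by (auto simp: dft_slices_def)

lemma dft_slices_index:
  "p < n3 \<Longrightarrow> j1 < n1 \<Longrightarrow> j2 < n2 \<Longrightarrow> (dft_slices n1 n2 n3 T ! p) $$ (j1, j2)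
     = of_real (sqrt (real n3)) * (\<Sum>m<n3. dft_mat n3 $$ (p, m) * of_real (T j1 j2 m))"
  by (simp add: dft_slices_def)

text \<open>
  At a fixed position inside the blocks, \<open>bcirc T\<close> is a scalar circulant, so the entry is that of
  the diagonalised circulant.
\<close>
lemma bcirc_fourier_diagonal:
  "kronecker (dft_mat n3) (1\<^sub>m n1) * map_mat complex_of_real (bcirc n1 n2 n3 T)
     * kronecker (mat_adjoint (dft_mat n3)) (1\<^sub>m n2)
   = diag_block_mat (dft_slices n1 n2 n3 T)" (is "?L * ?C * ?R = ?D")
proof (rule eq_matI)
  have L: "?L \<in> carrier_mat (n3 * n1) (n3 * n1)"
    by (rule kronecker_one_carrier[OF dft_mat_carrier])
  have C: "?C \<in> carrier_mat (n3 * n1) (n3 * n2)"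
    by (simp add: bcirc_def mult.commute)
  have F_adj: "mat_adjoint (dft_mat n3) \<in> carrier_mat n3 n3"
    by (rule mat_adjoint_carrier[OF dft_mat_carrier])
  have R: "?R \<in> carrier_mat (n3 * n2) (n3 * n2)"
    by (rule kronecker_one_carrier[OF F_adj])
  have D: "?D \<in> carrier_mat (n3 * n1) (n3 * n2)"
    using diag_block_mat_uniform_carrier[OF dft_slices_carrier(2)] by (simp add: dft_slices_carrier(1))
  show "dim_row (?L * ?C * ?R) = dim_row ?D" "dim_col (?L * ?C * ?R) = dim_col ?D"
    using L R D by auto
  fix i j assume "i < dim_row ?D" "j < dim_col ?D"
  then have i: "i < n3 * n1" and j: "j < n3 * n2" using D by auto
  note ij = div_less_of_less_mult[OF i] mod_less_of_less_mult[OF i]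
    div_less_of_less_mult[OF j] mod_less_of_less_mult[OF j]
  let ?c = "\<lambda>m. complex_of_real (T (i mod n1) (j mod n2) m)"
  have entry: "?C $$ (k * n1 + i mod n1, l * n2 + j mod n2) = ?c (nat ((int k - int l) mod int n3))"
    if "k < n3" "l < n3" for k l
    using block_index_less[OF that(1) ij(2)] block_index_less[OF that(2) ij(4)] ij
    by (simp add: bcirc_def mult.commute)
  have "(?L * ?C * ?R) $$ (i, j)
      = (\<Sum>l<n3. (?L * ?C) $$ (i, l * n2 + j mod n2) * mat_adjoint (dft_mat n3) $$ (l, j div n2))"
    using mult_kronecker_one_index[OF F_adj _ i j] L C by simp
  also have "\<dots> = (\<Sum>l<n3. (\<Sum>k<n3. dft_mat n3 $$ (i div n1, k) * ?c (nat ((int k - int l) mod int n3)))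
      * mat_adjoint (dft_mat n3) $$ (l, j div n2))"
    by (intro sum.cong refl arg_cong2[where f = "(*)"])
      (simp add: kronecker_one_mult_index[OF dft_mat_carrier C i] block_index_less ij entry
        del: index_mult_mat index_map_mat)
  also have "\<dots> = (if i div n1 = j div n2
      then of_real (sqrt (real n3)) * (\<Sum>m<n3. dft_mat n3 $$ (i div n1, m) * ?c m) else 0)"
    by (rule dft_mat_conj_circulant[OF ij(1) ij(3)])
  also have "\<dots> = ?D $$ (i, j)"
    using diag_block_mat_uniform_index[OF dft_slices_carrier(2), of i n1 n2 n3 T j] i j ij
    by (simp add: dft_slices_carrier(1) dft_slices_index)
  finally show "(?L * ?C * ?R) $$ (i, j) = ?D $$ (i, j)" .
qed

lemma fourier_blocks_iff: "fourier_blocks n1 n2 n3 T Ts \<longleftrightarrow> Ts = dft_slices n1 n2 n3 T"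
  unfolding fourier_blocks_def bcirc_fourier_diagonal
  using diag_block_mat_uniform_inject[of Ts n1 n2 "dft_slices n1 n2 n3 T"] dft_slices_carrier
  by metis

text \<open>
  Exchanging the order of summation lets the Fourier matrix act on \<open>U3\<close>, the only factor
  containing the third index.
\<close>
lemma dft_tucker_format:
  assumes "tucker_format n1 n2 n3 r1 r2 r3 T G U1 U2 U3"
    and "p < n3" "j1 < n1" "j2 < n2"
  shows "(\<Sum>m<n3. dft_mat n3 $$ (p, m) * complex_of_real (T j1 j2 m))
       = (\<Sum>a1<r1. \<Sum>a2<r2. \<Sum>a3<r3.
           complex_of_real (G a1 a2 a3) * complex_of_real (U1 $$ (j1, a1))
             * complex_of_real (U2 $$ (j2, a2))
             * (dft_mat n3 * map_mat complex_of_real U3) $$ (p, a3))" (is "?lhs = ?rhs")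
proof -
  have U3: "U3 \<in> carrier_mat n3 r3"
    and T: "\<And>m. m < n3 \<Longrightarrow> T j1 j2 m =
        (\<Sum>a1<r1. \<Sum>a2<r2. \<Sum>a3<r3. G a1 a2 a3 * U1 $$ (j1, a1) * U2 $$ (j2, a2) * U3 $$ (m, a3))"
    using assms unfolding tucker_format_def by auto
  let ?g = "\<lambda>a1 a2 a3. complex_of_real (G a1 a2 a3) * complex_of_real (U1 $$ (j1, a1))
      * complex_of_real (U2 $$ (j2, a2))"
  have U3t: "(dft_mat n3 * map_mat complex_of_real U3) $$ (p, a3)
      = (\<Sum>m<n3. dft_mat n3 $$ (p, m) * complex_of_real (U3 $$ (m, a3)))" if "a3 < r3" for a3
    using U3 that \<open>p < n3\<close> dft_mat_carrier[of n3]
    by (auto simp: scalar_prod_def lessThan_atLeast0 intro!: sum.cong)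
  have "?lhs = (\<Sum>m<n3. \<Sum>a1<r1. \<Sum>a2<r2. \<Sum>a3<r3.
      ?g a1 a2 a3 * (dft_mat n3 $$ (p, m) * complex_of_real (U3 $$ (m, a3))))"
    by (simp add: T sum_distrib_left ac_simps)
  also have "\<dots> = (\<Sum>a1<r1. \<Sum>m<n3. \<Sum>a2<r2. \<Sum>a3<r3.
      ?g a1 a2 a3 * (dft_mat n3 $$ (p, m) * complex_of_real (U3 $$ (m, a3))))"
    by (rule sum.swap)
  also have "\<dots> = (\<Sum>a1<r1. \<Sum>a2<r2. \<Sum>m<n3. \<Sum>a3<r3.
      ?g a1 a2 a3 * (dft_mat n3 $$ (p, m) * complex_of_real (U3 $$ (m, a3))))"
    by (intro sum.cong refl sum.swap)
  also have "\<dots> = (\<Sum>a1<r1. \<Sum>a2<r2. \<Sum>a3<r3. \<Sum>m<n3.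
      ?g a1 a2 a3 * (dft_mat n3 $$ (p, m) * complex_of_real (U3 $$ (m, a3))))"
    by (intro sum.cong refl sum.swap)
  also have "\<dots> = ?rhs"
    by (intro sum.cong refl) (simp add: U3t sum_distrib_left)
  finally show ?thesis .
qed

(* The factor sqrt n3 is forced by the unitary normalisation of the Fourier matrix:
   conjugating bcirc T by it yields the unnormalised transform of T along the third mode. *)
theorem proposition3p2:
  fixes n1 n2 n3 r1 r2 r3 :: nat
    and T G :: "real tensor3"
    and U1 U2 U3 :: "real mat"
  assumes "tucker_format n1 n2 n3 r1 r2 r3 T G U1 U2 U3"
  defines "U3t \<equiv> dft_mat n3 * map_mat complex_of_real U3"
  shows "(\<exists>!Ts. fourier_blocks n1 n2 n3 T Ts) \<and>
    (\<forall>Ts. fourier_blocks n1 n2 n3 T Ts \<longrightarrow>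
      (\<forall>j3<n3. \<forall>j1<n1. \<forall>j2<n2. (Ts ! j3) $$ (j1, j2) =
        complex_of_real (sqrt (real n3)) *
        (\<Sum>a1<r1. \<Sum>a2<r2. \<Sum>a3<r3.
           complex_of_real (G a1 a2 a3) * complex_of_real (U1 $$ (j1, a1))
             * complex_of_real (U2 $$ (j2, a2)) * U3t $$ (j3, a3))))"
  unfolding U3t_def fourier_blocks_iff
  using dft_tucker_format[OF assms(1)] by (simp add: dft_slices_index)

end
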